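(* Let $G$ be a parabola in the Euclidean plane with focus $F$, and let $l_1$ and $l_2$ be two distinct lines tangent to $G$. Let $I = l_1 \cap l_2$ be their intersection point and let $C$ be any circle passing through the points $F$ and $I$. Let $H_i \in C \cap l_i$ for $i=1,2$, with at least one $H_i \neq I$. Then the line $H_1H_2$ is tangent to $G$.
   Context: All objects lie in the Euclidean plane. Any two distinct tangent lines of a parabola meet in a single point, so $I$ is well defined. *)

theory Defs
  imports "HOL-Analysis.Analysis"
begin

definition is_line :: "(real^2) set \<Rightarrow> bool" where
  "is_line l \<longleftrightarrow> affine l \<and> aff_dim l = 1"

text \<open>The set \<open>d\<close> is the directrix; requiring \<open>F \<notin> d\<close> excludes the degenerate locus, which is
  the line through \<open>F\<close> perpendicular to \<open>d\<close>.\<close>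

definition parabola_with_focus :: "(real^2) set \<Rightarrow> real^2 \<Rightarrow> bool" where
  "parabola_with_focus G F \<longleftrightarrow>
     (\<exists>d. is_line d \<and> F \<notin> d \<and> G = {X. dist X F = infdist X d})"

text \<open>A tangent line of a plane curve, given as a point set \<open>S\<close>: the line through a point
  \<open>\<gamma> t\<close> of \<open>S\<close> spanned by the nonzero velocity at \<open>t\<close> of a local \<open>C\<^sup>1\<close> parametrization \<open>\<gamma>\<close>
  of \<open>S\<close>. Since \<open>t\<close> is interior to the parameter interval, one-sided tangents at corners or
  endpoints do not count.\<close>

definition tangent_line :: "(real^2) set \<Rightarrow> (real^2) set \<Rightarrow> bool" where
  "tangent_line l S \<longleftrightarrow>
     (\<exists>(\<gamma> :: real \<Rightarrow> real^2) t e v. e > 0 \<and>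
        \<gamma> ` {t - e<..<t + e} \<subseteq> S \<and>
        \<gamma> C1_differentiable_on {t - e<..<t + e} \<and>
        (\<gamma> has_vector_derivative v) (at t) \<and> v \<noteq> 0 \<and>
        l = range (\<lambda>s. \<gamma> t + s *\<^sub>R v))"

end

theory Submission
  imports Defs
begin

text \<open>
  Use Cartesian coordinates with origin \<open>F\<close> whose second axis is normal to the directrix, and
  write \<open>2 * p\<close> for the distance from \<open>F\<close> to the directrix. The parabola is then parametrized by
  \<open>t \<mapsto> (2 * p * t, p * (t\<^sup>2 - 1))\<close>. Polarizing this quadratic map gives its blossom
  \<open>(s, t) \<mapsto> (p * (s + t), p * (s * t - 1))\<close>, which is symmetric in \<open>s\<close> and \<open>t\<close>. Fixing one
  argument \<open>t\<close> and varying the other gives the tangent at the point with parameter \<open>t\<close>, and all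
  tangent lines have this form (\<open>tangent_line_blossom\<close>, \<open>tangent_line_imp_blossom\<close>). By symmetry,
  the tangents with parameters \<open>s\<close> and \<open>t\<close> meet at the point \<open>blossom s t\<close>.

  So \<open>I = blossom t1 t2\<close>, \<open>H1 = blossom t1 m1\<close> and \<open>H2 = blossom t2 m2\<close>, and if \<open>m1\<close> and \<open>m2\<close> are
  the same number \<open>m\<close>, then both \<open>H1\<close> and \<open>H2\<close> lie on the tangent with parameter \<open>m\<close>.
  The squared distance of \<open>blossom s t\<close> from \<open>F\<close> factors as \<open>p\<^sup>2 * (s\<^sup>2 + 1) * (t\<^sup>2 + 1)\<close>, so for a
  circle through \<open>F\<close> the condition that \<open>blossom s t\<close> lies on it is a symmetric equation, quadratic
  in each of \<open>s\<close> and \<open>t\<close> (\<open>circle_through_focus\<close>). For \<open>s = t1\<close> its roots are \<open>t2\<close> and \<open>m1\<close>; for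
  \<open>s = t2\<close> they are \<open>t1\<close> and \<open>m2\<close>. Comparing the sums of the roots yields \<open>m1 = m2\<close>
  (\<open>symmetric_biquadratic_closes\<close>). If instead one of the \<open>H\<close>'s coincides with \<open>I\<close>, the line
  \<open>H1 H2\<close> is simply one of the two given tangents.
\<close>

section \<open>A symmetric correspondence\<close>

text \<open>
  The circle induces a symmetric correspondence \<open>Q\<close> between parameters, quadratic in each argument.
  Starting from a corresponding pair \<open>t1\<close>, \<open>t2\<close>, let \<open>m1\<close> and \<open>m2\<close> be the other partners of \<open>t1\<close>
  and \<open>t2\<close>. Vieta's formula for the sum of roots determines \<open>m1\<close> and \<open>m2\<close>, and
  after clearing denominators with \<open>Q t1 t2 = 0\<close> both are given by one expression symmetric in
  \<open>t1\<close> and \<open>t2\<close>.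
\<close>

lemma symmetric_biquadratic_closes:
  fixes p a b :: real
  defines "Q \<equiv> \<lambda>s t. p * (s\<^sup>2 + 1) * (t\<^sup>2 + 1) - 2 * (a * (s * t - 1) + b * (s + t))"
  assumes "p > 0" "Q t1 t2 = 0" "Q t1 m1 = 0" "Q t2 m2 = 0" "m1 \<noteq> t2" "m2 \<noteq> t1"
  shows "m1 = m2"
proof -
  \<comment> \<open>Subtracting the equations of two distinct roots and cancelling their difference leaves the
    sum of the roots.\<close>
  have "(m1 - t2) * (p * (t1\<^sup>2 + 1) * (m1 + t2) - 2 * (a * t1 + b)) = 0"
    using assms(3,4) unfolding Q_def by algebra
  then have 1: "p * (t1\<^sup>2 + 1) * (m1 + t2) = 2 * (a * t1 + b)" using assms(6) by simp
  have "(m2 - t1) * (p * (t2\<^sup>2 + 1) * (m2 + t1) - 2 * (a * t2 + b)) = 0"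
    using assms(3,5) unfolding Q_def by algebra
  then have 2: "p * (t2\<^sup>2 + 1) * (m2 + t1) = 2 * (a * t2 + b)" using assms(7) by simp
  have "p * (t1\<^sup>2 + 1) * (t2\<^sup>2 + 1) * m1 = 2 * (a * (t1 + t2) + b * (1 - t1 * t2))"
    using assms(3) 1 unfolding Q_def by algebra
  moreover have "p * (t1\<^sup>2 + 1) * (t2\<^sup>2 + 1) * m2 = 2 * (a * (t1 + t2) + b * (1 - t1 * t2))"
    using assms(3) 2 unfolding Q_def by algebra
  moreover have "p * (t1\<^sup>2 + 1) * (t2\<^sup>2 + 1) > 0"
    using assms(2) by (intro mult_pos_pos add_nonneg_pos) auto
  ultimately show ?thesis by (metis less_irrefl mult_left_cancel)
qed

section \<open>Coordinates adapted to a parabola\<close>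

text \<open>
  Here \<open>n\<close> is the unit normal of the directrix pointing towards the focus \<open>F\<close>, and \<open>p\<close> is half the
  distance from \<open>F\<close> to the directrix, that is, the distance from \<open>F\<close> to the vertex.
\<close>

locale parabola_frame =
  fixes F n :: "real^2" and p :: real
  assumes norm_n: "norm n = 1" and p_pos: "p > 0"
begin

definition u :: "real^2" where
  "u = vector [n $ 2, - n $ 1]"

text \<open>
  The polar form of the parametrization \<open>t \<mapsto> F + (2 * p * t) u + p * (t\<^sup>2 - 1) n\<close>: it is symmetric, affine
  in each argument, and restricts to the parametrization on the diagonal. If the point with
  coordinates \<open>x\<close>, \<open>y\<close> along \<open>u\<close>, \<open>n\<close> is read as the complex number \<open>y + \<i> x\<close>, it is
  \<open>p * (s + \<i>) * (t + \<i>)\<close>, which accounts for the product form of its distance from \<open>F\<close>.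
\<close>

definition blossom :: "real \<Rightarrow> real \<Rightarrow> real^2" where
  "blossom s t = F + (p * (s + t)) *\<^sub>R u + (p * (s * t - 1)) *\<^sub>R n"

definition parabola :: "(real^2) set" where
  "parabola = range (\<lambda>t. blossom t t)"

lemma frame_orthonormal: "n \<bullet> n = 1" "u \<bullet> u = 1" "u \<bullet> n = 0" "n \<bullet> u = 0"
proof -
  show nn: "n \<bullet> n = 1" using norm_n by (simp add: norm_eq_1)
  then show "u \<bullet> u = 1" by (simp add: u_def inner_vec_def sum_2)
  show "u \<bullet> n = 0" "n \<bullet> u = 0" by (simp_all add: u_def inner_vec_def sum_2)
qed

lemma frame_expansion: "X = (u \<bullet> X) *\<^sub>R u + (n \<bullet> X) *\<^sub>R n"
proof -
  have nn: "n $ 1 * n $ 1 + n $ 2 * n $ 2 = 1"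
    using frame_orthonormal(1) by (simp add: inner_vec_def sum_2)
  have "(n$2 * X$1 - n$1 * X$2) * n$2 + (n$1 * X$1 + n$2 * X$2) * n$1
        = (n $ 1 * n $ 1 + n $ 2 * n $ 2) * X$1"
    "- ((n$2 * X$1 - n$1 * X$2) * n$1) + (n$1 * X$1 + n$2 * X$2) * n$2
        = (n $ 1 * n $ 1 + n $ 2 * n $ 2) * X$2"
    by algebra+
  then show ?thesis
    by (simp add: nn vec_eq_iff forall_2 u_def inner_vec_def sum_2)
qed

lemma frame_eqI: "u \<bullet> X = u \<bullet> Y \<Longrightarrow> n \<bullet> X = n \<bullet> Y \<Longrightarrow> X = Y"
  using frame_expansion[of X] frame_expansion[of Y] by simp

lemma blossom_coords:
  "u \<bullet> (blossom s t - F) = p * (s + t)" "n \<bullet> (blossom s t - F) = p * (s * t - 1)"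
  by (simp_all add: blossom_def inner_add_right frame_orthonormal)

lemma blossom_commute: "blossom s t = blossom t s"
  by (simp add: blossom_def algebra_simps)

lemma blossom_along_tangent:
  "blossom t s = blossom t t + (p * (s - t)) *\<^sub>R (u + t *\<^sub>R n)"
  by (simp add: blossom_def vec_eq_iff algebra_simps)

lemma mem_parabola_iff:
  "X \<in> parabola \<longleftrightarrow> (u \<bullet> (X - F))\<^sup>2 = 4 * p * (n \<bullet> (X - F) + p)"
proof
  assume "X \<in> parabola"
  then obtain t where X: "X = blossom t t" by (auto simp: parabola_def)
  show "(u \<bullet> (X - F))\<^sup>2 = 4 * p * (n \<bullet> (X - F) + p)"
    unfolding X blossom_coords by algebra
next
  assume eq: "(u \<bullet> (X - F))\<^sup>2 = 4 * p * (n \<bullet> (X - F) + p)"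
  define t where "t = u \<bullet> (X - F) / (2 * p)"
  have ut: "u \<bullet> (X - F) = 2 * p * t" using p_pos by (simp add: t_def)
  have "p * (n \<bullet> (X - F)) = p * (p * (t * t - 1))"
    using eq unfolding ut by algebra
  then have nt: "n \<bullet> (X - F) = p * (t * t - 1)" using p_pos by simp
  have "X - F = blossom t t - F"
    by (rule frame_eqI) (simp_all only: blossom_coords ut nt, simp)
  then have "X = blossom t t" by simp
  then show "X \<in> parabola" by (auto simp: parabola_def)
qed

section \<open>Tangent lines of the parabola\<close>

lemma tangent_direction_range:
  assumes "a \<noteq> 0"
  shows "range (\<lambda>s. blossom t t + s *\<^sub>R (a *\<^sub>R (u + t *\<^sub>R n))) = range (blossom t)"
proof (intro equalityI subsetI)
  fix X assume "X \<in> range (\<lambda>s. blossom t t + s *\<^sub>R (a *\<^sub>R (u + t *\<^sub>R n)))"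
  then obtain s where "X = blossom t t + s *\<^sub>R (a *\<^sub>R (u + t *\<^sub>R n))" by blast
  also have "\<dots> = blossom t (t + s * a / p)"
    using p_pos by (simp add: blossom_along_tangent[of t "t + s * a / p"])
  finally show "X \<in> range (blossom t)" by blast
next
  fix X assume "X \<in> range (blossom t)"
  then obtain s where "X = blossom t s" by blast
  also have "\<dots> = blossom t t + (p * (s - t) / a) *\<^sub>R (a *\<^sub>R (u + t *\<^sub>R n))"
    using assms by (simp add: blossom_along_tangent[of t s])
  finally show "X \<in> range (\<lambda>s. blossom t t + s *\<^sub>R (a *\<^sub>R (u + t *\<^sub>R n)))" by blast
qed

lemma tangent_line_blossom: "tangent_line (range (blossom t)) parabola"
proof -
  have deriv: "((\<lambda>t. blossom t t) has_vector_derivative ((2 * p) *\<^sub>R (u + x *\<^sub>R n))) (at x)" for x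
    unfolding blossom_def
    by (auto intro!: derivative_eq_intros simp: algebra_simps)
  have "(\<lambda>t. blossom t t) C1_differentiable_on {t - 1<..<t + 1}"
    unfolding C1_differentiable_on_def
    by (rule exI[of _ "\<lambda>x. (2 * p) *\<^sub>R (u + x *\<^sub>R n)"])
       (auto intro!: deriv continuous_intros)
  moreover have "(2 * p) *\<^sub>R (u + t *\<^sub>R n) \<noteq> 0"
  proof
    assume "(2 * p) *\<^sub>R (u + t *\<^sub>R n) = 0"
    then have "u \<bullet> (u + t *\<^sub>R n) = 0" using p_pos by simp
    then show False by (simp add: inner_add_right frame_orthonormal)
  qed
  moreover have "range (blossom t)
      = range (\<lambda>s. blossom t t + s *\<^sub>R ((2 * p) *\<^sub>R (u + t *\<^sub>R n)))"
    using p_pos by (intro tangent_direction_range[symmetric]) simp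
  moreover have "(\<lambda>t. blossom t t) ` {t - 1<..<t + 1} \<subseteq> parabola"
    by (auto simp: parabola_def)
  ultimately show ?thesis
    unfolding tangent_line_def using deriv[of t] zero_less_one by blast
qed

text \<open>
  Any \<open>C\<^sup>1\<close> curve inside the parabola, whatever its parametrization, satisfies the Cartesian equation
  identically near \<open>t0\<close>. Differentiating that equation forces the velocity to be a multiple of
  \<open>u + t n\<close>, so the tangent is already determined by the point of contact.
\<close>

lemma tangent_line_imp_blossom:
  assumes "tangent_line l parabola"
  obtains t where "l = range (blossom t)"
proof -
  obtain \<gamma> t0 e v where e: "e > 0"
    and sub: "\<gamma> ` {t0 - e<..<t0 + e} \<subseteq> parabola"
    and d: "(\<gamma> has_vector_derivative v) (at t0)" and v: "v \<noteq> 0"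
    and l: "l = range (\<lambda>s. \<gamma> t0 + s *\<^sub>R v)"
    using assms unfolding tangent_line_def by blast
  have t0: "t0 \<in> {t0 - e<..<t0 + e}" using e by simp
  then obtain t where t: "\<gamma> t0 = blossom t t" using sub unfolding parabola_def by blast
  let ?f = "\<lambda>s. (u \<bullet> (\<gamma> s - F))\<^sup>2 - 4 * p * (n \<bullet> (\<gamma> s - F) + p)"
  have dx: "((\<lambda>s. w \<bullet> (\<gamma> s - F)) has_real_derivative w \<bullet> v) (at t0)" for w
  proof -
    have "((\<lambda>s. \<gamma> s - F) has_vector_derivative v) (at t0)"
      using d by (auto intro!: derivative_eq_intros)
    from bounded_linear.has_vector_derivative[OF bounded_linear_inner_right this]
    show ?thesis by (simp add: has_real_derivative_iff_has_vector_derivative)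
  qed
  have "(?f has_real_derivative 2 * (u \<bullet> (\<gamma> t0 - F)) * (u \<bullet> v) - 4 * p * (n \<bullet> v)) (at t0)"
    by (auto intro!: derivative_eq_intros dx)
  then have "((\<lambda>_. 0) has_real_derivative
      2 * (u \<bullet> (\<gamma> t0 - F)) * (u \<bullet> v) - 4 * p * (n \<bullet> v)) (at t0)"
    by (rule has_field_derivative_transform_within_open[OF _ open_greaterThanLessThan t0])
       (use sub in \<open>simp add: image_subset_iff mem_parabola_iff\<close>)
  then have "2 * (u \<bullet> (\<gamma> t0 - F)) * (u \<bullet> v) - 4 * p * (n \<bullet> v) = 0"
    by (rule DERIV_unique) simp
  then have "4 * p * (n \<bullet> v) = 4 * p * (t * (u \<bullet> v))"
    unfolding t blossom_coords by algebra
  then have nv: "n \<bullet> v = t * (u \<bullet> v)" using p_pos by simp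
  have v_eq: "v = (u \<bullet> v) *\<^sub>R (u + t *\<^sub>R n)"
    using frame_expansion[of v] by (simp add: nv algebra_simps)
  then have "u \<bullet> v \<noteq> 0" using v by force
  then have "l = range (blossom t)"
    unfolding l t using tangent_direction_range[of "u \<bullet> v" t] v_eq by simp
  then show thesis by (rule that)
qed

lemma affine_hull_blossom:
  assumes "x \<noteq> y"
  shows "affine hull {blossom t x, blossom t y} = range (blossom t)"
proof (intro equalityI subsetI)
  fix X assume "X \<in> affine hull {blossom t x, blossom t y}"
  then obtain a b where ab: "a + b = 1" and X: "X = a *\<^sub>R blossom t x + b *\<^sub>R blossom t y"
    by (auto simp: affine_hull_2)
  have a: "a = 1 - b" using ab by simp
  have "X = blossom t (a * x + b * y)"
    unfolding X a by (simp add: blossom_def algebra_simps)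
  then show "X \<in> range (blossom t)" by blast
next
  fix X assume "X \<in> range (blossom t)"
  then obtain s where X: "X = blossom t s" by blast
  define b where "b = (s - x) / (y - x)"
  have s: "s = (1 - b) * x + b * y"
  proof -
    have "b * (y - x) = s - x" using assms by (simp add: b_def)
    then show ?thesis by algebra
  qed
  have "X = (1 - b) *\<^sub>R blossom t x + b *\<^sub>R blossom t y"
    unfolding X s by (simp add: blossom_def algebra_simps)
  then show "X \<in> affine hull {blossom t x, blossom t y}"
    unfolding affine_hull_2 by (intro CollectI exI[of _ "1 - b"] exI[of _ b]) simp
qed

section \<open>Circles through the focus\<close>

text \<open>
  A point \<open>F + z\<close> lies on a circle through \<open>F\<close> with centre \<open>c\<close> iff \<open>z \<bullet> z = 2 * ((c - F) \<bullet> z)\<close>. On the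
  blossom, the left side factors because
  \<open>(s + t)\<^sup>2 + (s * t - 1)\<^sup>2 = (s\<^sup>2 + 1) * (t\<^sup>2 + 1)\<close>, and one factor \<open>p\<close> cancels.
\<close>

lemma circle_through_focus:
  assumes "F \<in> sphere c r" "blossom s t \<in> sphere c r"
  shows "p * (s\<^sup>2 + 1) * (t\<^sup>2 + 1)
      = 2 * (n \<bullet> (c - F) * (s * t - 1) + u \<bullet> (c - F) * (s + t))"
proof -
  let ?z = "blossom s t - F"
  have "dist c F = dist c (blossom s t)" using assms by simp
  then have "(c - F) \<bullet> (c - F) = (c - F - ?z) \<bullet> (c - F - ?z)"
    by (simp add: dist_norm norm_eq)
  then have z: "?z \<bullet> ?z = 2 * ((c - F) \<bullet> ?z)"
    by (simp add: inner_diff_left inner_diff_right inner_commute)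
  have exp: "w \<bullet> ?z = u \<bullet> w * (p * (s + t)) + n \<bullet> w * (p * (s * t - 1))" for w
    by (simp add: blossom_def inner_add_right inner_commute)
  have "p * (p * (s\<^sup>2 + 1) * (t\<^sup>2 + 1)) = (p * (s + t))\<^sup>2 + (p * (s * t - 1))\<^sup>2"
    by algebra
  also have "\<dots> = ?z \<bullet> ?z"
    unfolding exp[of ?z] by (simp only: blossom_coords power2_eq_square)
  also have "\<dots> = p * (2 * (n \<bullet> (c - F) * (s * t - 1) + u \<bullet> (c - F) * (s + t)))"
    unfolding z exp[of "c - F"] by algebra
  finally show ?thesis using p_pos by simp
qed

end

section \<open>Parabolas given by focus and directrix\<close>

lemma infdist_unit_hyperplane:
  fixes n X :: "'a::euclidean_space"
  assumes "norm n = 1"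
  shows "infdist X {Y. n \<bullet> Y = k} = \<bar>n \<bullet> X - k\<bar>"
proof -
  have nn: "n \<bullet> n = 1" using assms by (simp add: norm_eq_1)
  let ?Y = "X - (n \<bullet> X - k) *\<^sub>R n"
  have Y: "?Y \<in> {Y. n \<bullet> Y = k}" by (simp add: inner_diff_right nn)
  have "dist X ?Y = \<bar>n \<bullet> X - k\<bar>" using assms by (simp add: dist_norm)
  then have "infdist X {Y. n \<bullet> Y = k} \<le> \<bar>n \<bullet> X - k\<bar>" using infdist_le[OF Y, of X] by linarith
  moreover have "\<bar>n \<bullet> X - k\<bar> \<le> infdist X {Y. n \<bullet> Y = k}"
  proof -
    have "\<bar>n \<bullet> X - k\<bar> \<le> dist X Z" if "n \<bullet> Z = k" for Z
      using Cauchy_Schwarz_ineq2[of n "X - Z"] that assms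
      by (simp add: inner_diff_right dist_norm)
    then show ?thesis using Y by (subst infdist_notempty) (auto intro!: cINF_greatest)
  qed
  ultimately show ?thesis by simp
qed

text \<open>
  The sign of the normal is chosen so that it points to the side of \<open>F\<close>; this is what makes the
  parameter \<open>p\<close> of the frame positive.
\<close>

lemma is_line_unit_normal:
  assumes "is_line d" "F \<notin> d"
  obtains n k where "norm n = 1" "d = {X. n \<bullet> X = k}" "n \<bullet> F > k"
proof -
  have hull: "affine hull d = d" and dim: "aff_dim d = int (DIM(real^2) - 1)"
    using assms(1) by (simp_all add: is_line_def hull_same)
  obtain a b where a: "a \<noteq> 0" and d: "d = {X. a \<bullet> X = b}"
    using iffD1[OF aff_dim_eq_hyperplane dim] unfolding hull by blast
  define \<epsilon> where "\<epsilon> = sgn (a \<bullet> F - b) / norm a"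
  have nz: "a \<bullet> F - b \<noteq> 0" using assms(2) d by simp
  then have e: "\<epsilon> \<noteq> 0" using a by (simp add: \<epsilon>_def sgn_0_0)
  show thesis
  proof
    show "norm (\<epsilon> *\<^sub>R a) = 1" using a nz by (simp add: \<epsilon>_def abs_sgn_eq)
    show "d = {X. \<epsilon> *\<^sub>R a \<bullet> X = \<epsilon> * b}" using d e by simp
    have "\<epsilon> * (a \<bullet> F - b) = \<bar>a \<bullet> F - b\<bar> / norm a"
      by (simp add: \<epsilon>_def abs_sgn mult.commute)
    also have "\<dots> > 0" using a nz by simp
    finally show "\<epsilon> *\<^sub>R a \<bullet> F > \<epsilon> * b" by (simp add: algebra_simps)
  qed
qed

lemma parabola_with_focus_frame:
  assumes "parabola_with_focus G F"
  obtains n p where "parabola_frame n p" "G = parabola_frame.parabola F n p"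
proof -
  obtain d where "is_line d" "F \<notin> d" and G: "G = {X. dist X F = infdist X d}"
    using assms unfolding parabola_with_focus_def by blast
  then obtain n k where n: "norm n = 1" and d: "d = {X. n \<bullet> X = k}" and k: "n \<bullet> F > k"
    using is_line_unit_normal by metis
  define p where "p = (n \<bullet> F - k) / 2"
  interpret parabola_frame F n p
    using n k by unfold_locales (simp_all add: p_def)
  have "dist X F = infdist X d \<longleftrightarrow> X \<in> parabola" for X
  proof -
    let ?x = "u \<bullet> (X - F)" and ?y = "n \<bullet> (X - F)"
    have "(X - F) \<bullet> (X - F) = ((?x *\<^sub>R u + ?y *\<^sub>R n)) \<bullet> (?x *\<^sub>R u + ?y *\<^sub>R n)"
      using frame_expansion[of "X - F"] by simp
    also have "\<dots> = ?x\<^sup>2 + ?y\<^sup>2"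
      by (simp add: inner_add_left inner_add_right frame_orthonormal power2_eq_square)
    finally have norm2: "(dist X F)\<^sup>2 = ?x\<^sup>2 + ?y\<^sup>2"
      by (simp add: dist_norm power2_norm_eq_inner)
    have "n \<bullet> X - k = ?y + 2 * p" unfolding p_def inner_diff_right by argo
    then have "infdist X d = \<bar>?y + 2 * p\<bar>"
      unfolding d infdist_unit_hyperplane[OF n] by (rule arg_cong)
    then have "dist X F = infdist X d \<longleftrightarrow> (dist X F)\<^sup>2 = (?y + 2 * p)\<^sup>2"
      using power2_eq_iff_nonneg[of "dist X F" "\<bar>?y + 2 * p\<bar>"] by simp
    \<comment> \<open>The term \<open>?y\<^sup>2\<close> cancels, leaving the Cartesian equation.\<close>
    also have "\<dots> \<longleftrightarrow> ?x\<^sup>2 = 4 * p * (?y + p)"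
      unfolding norm2 by (auto simp: power2_eq_square algebra_simps)
    finally show ?thesis by (simp add: mem_parabola_iff)
  qed
  then have "G = parabola" using G by blast
  then show thesis using that parabola_frame_axioms by blast
qed

section \<open>The third tangent\<close>

theorem theorem3:
  fixes G l1 l2 C :: "(real^2) set" and F I H1 H2 c :: "real^2" and r :: real
  assumes "parabola_with_focus G F"
    and "tangent_line l1 G" and "tangent_line l2 G" and "l1 \<noteq> l2"
    and "l1 \<inter> l2 = {I}"
    and "r > 0" and "C = sphere c r" and "F \<in> C" and "I \<in> C"
    and "H1 \<in> C \<inter> l1" and "H2 \<in> C \<inter> l2" and "H1 \<noteq> I \<or> H2 \<noteq> I"
  shows "tangent_line (affine hull {H1, H2}) G"
proof -
  obtain n p where frame: "parabola_frame n p" and G: "G = parabola_frame.parabola F n p"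
    using parabola_with_focus_frame[OF assms(1)] .
  interpret parabola_frame F n p by (rule frame)
  obtain t1 t2 where l1: "l1 = range (blossom t1)" and l2: "l2 = range (blossom t2)"
    using assms(2,3) tangent_line_imp_blossom unfolding G by metis
  have ne: "t1 \<noteq> t2" using l1 l2 assms(4) by blast
  have "blossom t1 t2 \<in> l1 \<inter> l2" unfolding l1 l2 using blossom_commute[of t1 t2] by blast
  then have I: "I = blossom t1 t2" using assms(5) by simp
  obtain m1 m2 where H1: "H1 = blossom t1 m1" and H2: "H2 = blossom t2 m2"
    using assms(10,11) l1 l2 by blast
  have circ: "F \<in> sphere c r" "blossom t1 t2 \<in> sphere c r"
    "blossom t1 m1 \<in> sphere c r" "blossom t2 m2 \<in> sphere c r"
    using assms(7-11) I H1 H2 by simp_all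
  \<comment> \<open>\<open>H1 = I\<close> when \<open>m1 = t2\<close>, and \<open>H2 = I\<close> when \<open>m2 = t1\<close>; both together are excluded.\<close>
  consider "m1 = t2" "m2 \<noteq> t1" | "m2 = t1" "m1 \<noteq> t2" | "m1 \<noteq> t2" "m2 \<noteq> t1"
    using assms(12) I H1 H2 blossom_commute by metis
  then have "\<exists>t. affine hull {H1, H2} = range (blossom t)"
  proof cases
    case 1
    then have "affine hull {H1, H2} = range (blossom t2)"
      using affine_hull_blossom[of t1 m2 t2] H1 H2 blossom_commute by metis
    then show ?thesis ..
  next
    case 2
    then have "affine hull {H1, H2} = range (blossom t1)"
      using affine_hull_blossom[of m1 t2 t1] H1 H2 blossom_commute by metis
    then show ?thesis ..
  next
    case 3
    have "m1 = m2"
      using symmetric_biquadratic_closes[OF p_pos _ _ _ 3]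
        circle_through_focus[OF circ(1,2)] circle_through_focus[OF circ(1,3)]
        circle_through_focus[OF circ(1,4)] by simp
    then have "affine hull {H1, H2} = range (blossom m1)"
      using affine_hull_blossom[OF ne, of m1] H1 H2 blossom_commute by metis
    then show ?thesis ..
  qed
  then show ?thesis unfolding G using tangent_line_blossom by metis
qed

end
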